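(* Let $(\mathcal{M},\varphi,\xi,\eta,g)$ be an almost contact complex Riemannian manifold with associated B-metric $\tilde g$, equipped with a Yamabe almost soliton $(\tilde g;\tilde\vartheta,\tilde\lambda)$, where the potential $\tilde\vartheta=\tilde k\,\xi$ is vertical and is a torse-forming vector field with respect to $\tilde g$ with conformal scalar $\tilde f$. Then the scalar curvature $\tilde\tau$ of $\tilde g$ is the sum of the conformal scalar $\tilde f$ of $\tilde\vartheta$ and the soliton function $\tilde\lambda$, i.e. $\tilde\tau=\tilde f+\tilde\lambda$.
   Context: An almost contact complex Riemannian (accR) manifold, also called an almost contact B-metric manifold, $(\mathcal{M},\varphi,\xi,\eta,g)$ is a differentiable (smooth) manifold $\mathcal{M}$ of dimension $2n+1$, $n\geq 1$, with an endomorphism $\varphi$ of the tangent bundle $T\mathcal{M}$, a vector field $\xi$ (the Reeb vector field), a 1-form $\eta$ and a pseudo-Riemannian metric $g$ of signature $(n+1,n)$ such that $$\varphi\xi=0,\quad \varphi^2=-\mathrm{Id}+\eta\otimes\xi,\quad \eta\circ\varphi=0,\quad \eta(\xi)=1,\quad g(\varphi x,\varphi y)=-g(x,y)+\eta(x)\eta(y)$$ for all vector fields $x,y$. The associated B-metric $\tilde g$ is the pseudo-Riemannian metric $\tilde g(x,y)=g(x,\varphi y)+\eta(x)\eta(y)$, and $\tilde\nabla$ denotes its Levi-Civita connection. A Yamabe almost soliton generated by $\tilde g$, denoted $(\tilde g;\tilde\vartheta,\tilde\lambda)$, consists of a vector field $\tilde\vartheta$ (the potential) and a differentiable function $\tilde\lambda$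 (the soliton function) on $\mathcal{M}$ with $\frac12\mathcal{L}_{\tilde\vartheta}\tilde g=(\tilde\tau-\tilde\lambda)\tilde g$, where $\mathcal{L}$ is the Lie derivative and $\tilde\tau$ is the scalar curvature of $\tilde g$. The potential is vertical if $\tilde\vartheta=\tilde k\,\xi$ for a differentiable function $\tilde k$ on $\mathcal{M}$ with $\tilde k(p)\neq0$ at every point $p\in\mathcal{M}$. A vector field $\tilde\vartheta$ is torse-forming with respect to $\tilde g$ if $\tilde\nabla_x\tilde\vartheta=\tilde f\,x+\tilde\gamma(x)\tilde\vartheta$ for every vector field $x$, where $\tilde f$ is a differentiable function (the conformal scalar of $\tilde\vartheta$) and $\tilde\gamma$ is a 1-form (the generating form of $\tilde\vartheta$). *)

theory Defs
  imports "HOL-Analysis.Analysis" "HOL-Library.Function_Algebras"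
begin

section \<open>Smooth manifolds\<close>

text \<open>The manifold is a whole type \<open>'a\<close> (Hausdorff, second countable) together with a smooth atlas
  modelled on a Euclidean space \<open>'e\<close>.\<close>

primrec Ck_on :: "nat \<Rightarrow> 'e::euclidean_space set \<Rightarrow> ('e \<Rightarrow> 'b::real_normed_vector) \<Rightarrow> bool" where
  "Ck_on 0 S f \<longleftrightarrow> continuous_on S f"
| "Ck_on (Suc k) S f \<longleftrightarrow> (\<forall>x\<in>S. f differentiable (at x)) \<and>
     (\<forall>v. Ck_on k S (\<lambda>x. frechet_derivative f (at x) v))"

text \<open>Only used for open \<open>S\<close>.\<close>
definition smooth_on :: "'e::euclidean_space set \<Rightarrow> ('e \<Rightarrow> 'b::real_normed_vector) \<Rightarrow> bool" where
  "smooth_on S f \<longleftrightarrow> (\<forall>k. Ck_on k S f)"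

text \<open>Values of \<open>cmap K\<close> outside \<open>cdom K\<close> are irrelevant.\<close>
datatype ('a, 'e) chart = Chart (cdom: "'a set") (cmap: "'a \<Rightarrow> 'e")

definition cinv :: "('a, 'e) chart \<Rightarrow> 'e \<Rightarrow> 'a" where
  "cinv K = inv_into (cdom K) (cmap K)"

definition is_chart ::
  "('a::topological_space, 'e::euclidean_space) chart \<Rightarrow> bool" where
  "is_chart K \<longleftrightarrow> open (cdom K) \<and> open (cmap K ` cdom K) \<and>
     homeomorphism (cdom K) (cmap K ` cdom K) (cmap K) (cinv K)"

definition smooth_atlas ::
  "('a::{t2_space, second_countable_topology}, 'e::euclidean_space) chart set \<Rightarrow> bool" where
  "smooth_atlas A \<longleftrightarrow> (\<forall>K\<in>A. is_chart K) \<and> (\<Union>K\<in>A. cdom K) = UNIV \<and>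
     (\<forall>K\<in>A. \<forall>L\<in>A. smooth_on (cmap K ` (cdom K \<inter> cdom L)) (cmap L \<circ> cinv K))"

definition charts_at :: "('a, 'e) chart set \<Rightarrow> 'a \<Rightarrow> ('a, 'e) chart set" where
  "charts_at A p = {K \<in> A. p \<in> cdom K}"

definition smooth_fun :: "('a, 'e::euclidean_space) chart set \<Rightarrow> ('a \<Rightarrow> real) \<Rightarrow> bool" where
  "smooth_fun A f \<longleftrightarrow> (\<forall>K\<in>A. smooth_on (cmap K ` cdom K) (f \<circ> cinv K))"


section \<open>Tangent vectors and vector fields\<close>

text \<open>A tangent vector at \<open>p\<close> assigns to every chart around \<open>p\<close> its component vector in that chart,
  the components in different charts being related by the Jacobian of the coordinate change.
  Being 0 at all other charts makes this representation unique. Addition is pointwise.\<close>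

type_synonym ('a, 'e) tvec = "('a, 'e) chart \<Rightarrow> 'e"
type_synonym ('a, 'e) vfield = "'a \<Rightarrow> ('a, 'e) tvec"

definition tscale :: "real \<Rightarrow> ('a, 'e::real_vector) tvec \<Rightarrow> ('a, 'e) tvec" where
  "tscale a v = (\<lambda>K. a *\<^sub>R v K)"

definition fscale :: "('a \<Rightarrow> real) \<Rightarrow> ('a, 'e::real_vector) vfield \<Rightarrow> ('a, 'e) vfield" where
  "fscale f X = (\<lambda>p. tscale (f p) (X p))"

definition tangent_space ::
  "('a, 'e::euclidean_space) chart set \<Rightarrow> 'a \<Rightarrow> ('a, 'e) tvec set" where
  "tangent_space A p = {v. (\<forall>K. K \<notin> charts_at A p \<longrightarrow> v K = 0) \<and>
     (\<forall>K\<in>charts_at A p. \<forall>L\<in>charts_at A p.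
        v L = frechet_derivative (cmap L \<circ> cinv K) (at (cmap K p)) (v K))}"

definition comp_in :: "('a, 'e) chart \<Rightarrow> ('a, 'e) vfield \<Rightarrow> 'e \<Rightarrow> 'e" where
  "comp_in K X = (\<lambda>x. X (cinv K x) K)"

definition smooth_vfield ::
  "('a, 'e::euclidean_space) chart set \<Rightarrow> ('a, 'e) vfield \<Rightarrow> bool" where
  "smooth_vfield A X \<longleftrightarrow> (\<forall>p. X p \<in> tangent_space A p) \<and>
     (\<forall>K\<in>A. smooth_on (cmap K ` cdom K) (comp_in K X))"

text \<open>Derivative of a function in the direction of a tangent vector; by the transformation law the
  value does not depend on the chart picked.\<close>
definition dir_deriv ::
  "('a, 'e::euclidean_space) chart set \<Rightarrow> 'a \<Rightarrow> ('a, 'e) tvec \<Rightarrow> ('a \<Rightarrow> real) \<Rightarrow> real" where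
  "dir_deriv A p v f = (let K = (SOME K. K \<in> charts_at A p)
     in frechet_derivative (f \<circ> cinv K) (at (cmap K p)) (v K))"

text \<open>In every chart, \<open>[X,Y]\<^sup>i = X\<^sup>j \<partial>\<^sub>j Y\<^sup>i - Y\<^sup>j \<partial>\<^sub>j X\<^sup>i\<close>.\<close>
definition bracket ::
  "('a, 'e::euclidean_space) chart set \<Rightarrow> ('a, 'e) vfield \<Rightarrow> ('a, 'e) vfield \<Rightarrow> ('a, 'e) vfield" where
  "bracket A X Y = (\<lambda>p K. if K \<in> charts_at A p
     then frechet_derivative (comp_in K Y) (at (cmap K p)) (X p K)
        - frechet_derivative (comp_in K X) (at (cmap K p)) (Y p K)
     else 0)"


section \<open>Tensor fields\<close>

text \<open>Tensor fields are families of multilinear maps on the tangent spaces; their values at arguments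
  outside \<open>tangent_space A p\<close> are irrelevant. Smoothness is expressed by smoothness of the
  values on smooth vector fields.\<close>

type_synonym ('a, 'e) form1 = "'a \<Rightarrow> ('a, 'e) tvec \<Rightarrow> real"
type_synonym ('a, 'e) form2 = "'a \<Rightarrow> ('a, 'e) tvec \<Rightarrow> ('a, 'e) tvec \<Rightarrow> real"
type_synonym ('a, 'e) endo = "'a \<Rightarrow> ('a, 'e) tvec \<Rightarrow> ('a, 'e) tvec"

definition smooth_endo :: "('a, 'e::euclidean_space) chart set \<Rightarrow> ('a, 'e) endo \<Rightarrow> bool" where
  "smooth_endo A \<phi> \<longleftrightarrow>
     (\<forall>p. \<forall>v\<in>tangent_space A p. \<phi> p v \<in> tangent_space A p) \<and>
     (\<forall>p. \<forall>v\<in>tangent_space A p. \<forall>w\<in>tangent_space A p. \<phi> p (v + w) = \<phi> p v + \<phi> p w) \<and>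
     (\<forall>p a. \<forall>v\<in>tangent_space A p. \<phi> p (tscale a v) = tscale a (\<phi> p v)) \<and>
     (\<forall>X. smooth_vfield A X \<longrightarrow> smooth_vfield A (\<lambda>p. \<phi> p (X p)))"

definition smooth_form1 :: "('a, 'e::euclidean_space) chart set \<Rightarrow> ('a, 'e) form1 \<Rightarrow> bool" where
  "smooth_form1 A \<omega> \<longleftrightarrow>
     (\<forall>p. \<forall>v\<in>tangent_space A p. \<forall>w\<in>tangent_space A p. \<omega> p (v + w) = \<omega> p v + \<omega> p w) \<and>
     (\<forall>p a. \<forall>v\<in>tangent_space A p. \<omega> p (tscale a v) = a * \<omega> p v) \<and>
     (\<forall>X. smooth_vfield A X \<longrightarrow> smooth_fun A (\<lambda>p. \<omega> p (X p)))"

definition pseudo_riemannian_metric ::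
  "('a, 'e::euclidean_space) chart set \<Rightarrow> ('a, 'e) form2 \<Rightarrow> bool" where
  "pseudo_riemannian_metric A g \<longleftrightarrow>
     (\<forall>p. \<forall>u\<in>tangent_space A p. \<forall>v\<in>tangent_space A p. \<forall>w\<in>tangent_space A p.
        g p (u + v) w = g p u w + g p v w) \<and>
     (\<forall>p a. \<forall>v\<in>tangent_space A p. \<forall>w\<in>tangent_space A p. g p (tscale a v) w = a * g p v w) \<and>
     (\<forall>p. \<forall>v\<in>tangent_space A p. \<forall>w\<in>tangent_space A p. g p v w = g p w v) \<and>
     (\<forall>p. \<forall>v\<in>tangent_space A p. (\<forall>w\<in>tangent_space A p. g p v w = 0) \<longrightarrow> v = 0) \<and>
     (\<forall>X Y. smooth_vfield A X \<longrightarrow> smooth_vfield A Y \<longrightarrow> smooth_fun A (\<lambda>p. g p (X p) (Y p)))"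

text \<open>At every point there is an orthonormal basis with \<open>r\<close> positive and \<open>s\<close> negative vectors
  (\<open>r + s\<close> orthonormal vectors are independent, and the tangent spaces have dimension
  \<open>DIM('e)\<close>).\<close>
definition has_signature ::
  "('a, 'e::euclidean_space) chart set \<Rightarrow> ('a, 'e) form2 \<Rightarrow> nat \<Rightarrow> nat \<Rightarrow> bool" where
  "has_signature A g r s \<longleftrightarrow> r + s = DIM('e) \<and>
     (\<forall>p. \<exists>e :: nat \<Rightarrow> ('a, 'e) tvec.
        (\<forall>i<r + s. e i \<in> tangent_space A p) \<and>
        (\<forall>i<r + s. \<forall>j<r + s.
           g p (e i) (e j) = (if i = j then (if i < r then 1 else - 1) else 0)))"

text \<open>\<open>(\<L>\<^sub>X h)(Y,Z) = X(h(Y,Z)) - h([X,Y],Z) - h(Y,[X,Z])\<close>.\<close>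
definition lie_deriv2 ::
  "('a, 'e::euclidean_space) chart set \<Rightarrow> ('a, 'e) vfield \<Rightarrow> ('a, 'e) form2
     \<Rightarrow> ('a, 'e) vfield \<Rightarrow> ('a, 'e) vfield \<Rightarrow> 'a \<Rightarrow> real" where
  "lie_deriv2 A X h Y Z p = dir_deriv A p (X p) (\<lambda>q. h q (Y q) (Z q))
     - h p (bracket A X Y p) (Z p) - h p (Y p) (bracket A X Z p)"


section \<open>Levi-Civita connection and curvature\<close>

type_synonym ('a, 'e) conn = "('a, 'e) vfield \<Rightarrow> ('a, 'e) vfield \<Rightarrow> ('a, 'e) vfield"

definition affine_connection ::
  "('a, 'e::euclidean_space) chart set \<Rightarrow> ('a, 'e) conn \<Rightarrow> bool" where
  "affine_connection A D \<longleftrightarrow>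
     (\<forall>X Y. smooth_vfield A X \<longrightarrow> smooth_vfield A Y \<longrightarrow> smooth_vfield A (D X Y)) \<and>
     (\<forall>X X' Y. smooth_vfield A X \<longrightarrow> smooth_vfield A X' \<longrightarrow> smooth_vfield A Y \<longrightarrow>
        D (X + X') Y = D X Y + D X' Y) \<and>
     (\<forall>X Y Y'. smooth_vfield A X \<longrightarrow> smooth_vfield A Y \<longrightarrow> smooth_vfield A Y' \<longrightarrow>
        D X (Y + Y') = D X Y + D X Y') \<and>
     (\<forall>f X Y. smooth_fun A f \<longrightarrow> smooth_vfield A X \<longrightarrow> smooth_vfield A Y \<longrightarrow>
        D (fscale f X) Y = fscale f (D X Y)) \<and>
     (\<forall>f X Y. smooth_fun A f \<longrightarrow> smooth_vfield A X \<longrightarrow> smooth_vfield A Y \<longrightarrow>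
        D X (fscale f Y) = fscale (\<lambda>p. dir_deriv A p (X p) f) Y + fscale f (D X Y))"

definition levi_civita ::
  "('a, 'e::euclidean_space) chart set \<Rightarrow> ('a, 'e) form2 \<Rightarrow> ('a, 'e) conn \<Rightarrow> bool" where
  "levi_civita A g D \<longleftrightarrow> affine_connection A D \<and>
     (\<forall>X Y. smooth_vfield A X \<longrightarrow> smooth_vfield A Y \<longrightarrow> D X Y - D Y X = bracket A X Y) \<and>
     (\<forall>X Y Z p. smooth_vfield A X \<longrightarrow> smooth_vfield A Y \<longrightarrow> smooth_vfield A Z \<longrightarrow>
        dir_deriv A p (X p) (\<lambda>q. g q (Y q) (Z q)) = g p (D X Y p) (Z p) + g p (Y p) (D X Z p))"

definition curvature ::
  "('a, 'e::euclidean_space) chart set \<Rightarrow> ('a, 'e) conn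
     \<Rightarrow> ('a, 'e) vfield \<Rightarrow> ('a, 'e) vfield \<Rightarrow> ('a, 'e) vfield \<Rightarrow> ('a, 'e) vfield" where
  "curvature A D X Y Z = D X (D Y Z) - D Y (D X Z) - D (bracket A X Y) Z"

text \<open>Smooth vector fields \<open>E\<^sub>0, \<dots>, E\<^sub>m\<^sub>-\<^sub>1\<close>, where \<open>m\<close> is the dimension, whose Gram matrix at \<open>p\<close> has
  inverse \<open>h = (g\<^sup>i\<^sup>j)\<close>; in particular their values at \<open>p\<close> form a basis of the tangent space.\<close>
definition frame_at ::
  "('a, 'e::euclidean_space) chart set \<Rightarrow> ('a, 'e) form2 \<Rightarrow> 'a
     \<Rightarrow> (nat \<Rightarrow> ('a, 'e) vfield) \<Rightarrow> (nat \<Rightarrow> nat \<Rightarrow> real) \<Rightarrow> bool" where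
  "frame_at A g p E h \<longleftrightarrow> (\<forall>i<DIM('e). smooth_vfield A (E i)) \<and>
     (\<forall>i<DIM('e). \<forall>j<DIM('e).
        (\<Sum>k<DIM('e). h i k * g p (E k p) (E j p)) = (if i = j then 1 else 0))"

text \<open>\<open>\<rho>(Y,Z) = g\<^sup>i\<^sup>j g(R(E\<^sub>i,Y)Z,E\<^sub>j)\<close>, the trace of \<open>X \<mapsto> R(X,Y)Z\<close>. When \<open>D\<close> is an affine connection
  the sum does not depend on the frame, nor does the one for the scalar curvature.\<close>
definition ricci ::
  "('a, 'e::euclidean_space) chart set \<Rightarrow> ('a, 'e) form2 \<Rightarrow> ('a, 'e) conn
     \<Rightarrow> ('a, 'e) vfield \<Rightarrow> ('a, 'e) vfield \<Rightarrow> 'a \<Rightarrow> real" where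
  "ricci A g D Y Z p = (THE t. \<exists>E h. frame_at A g p E h \<and>
     t = (\<Sum>i<DIM('e). \<Sum>j<DIM('e). h i j * g p (curvature A D (E i) Y Z p) (E j p)))"

text \<open>\<open>\<tau> = g\<^sup>i\<^sup>j \<rho>(E\<^sub>i,E\<^sub>j)\<close>; \<open>D\<close> is meant to be the Levi-Civita connection of \<open>g\<close>.\<close>
definition scalar_curvature ::
  "('a, 'e::euclidean_space) chart set \<Rightarrow> ('a, 'e) form2 \<Rightarrow> ('a, 'e) conn \<Rightarrow> 'a \<Rightarrow> real" where
  "scalar_curvature A g D p = (THE t. \<exists>E h. frame_at A g p E h \<and>
     t = (\<Sum>i<DIM('e). \<Sum>j<DIM('e). h i j * ricci A g D (E i) (E j) p))"


section \<open>Almost contact complex Riemannian manifolds\<close>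

definition accR_manifold ::
  "nat \<Rightarrow> ('a::{t2_space, second_countable_topology}, 'e::euclidean_space) chart set \<Rightarrow> ('a, 'e) endo
     \<Rightarrow> ('a, 'e) vfield \<Rightarrow> ('a, 'e) form1 \<Rightarrow> ('a, 'e) form2 \<Rightarrow> bool" where
  "accR_manifold n A \<phi> \<xi> \<eta> g \<longleftrightarrow>
     n \<ge> 1 \<and> DIM('e) = 2 * n + 1 \<and> smooth_atlas A \<and>
     smooth_endo A \<phi> \<and> smooth_vfield A \<xi> \<and> smooth_form1 A \<eta> \<and>
     pseudo_riemannian_metric A g \<and> has_signature A g (n + 1) n \<and>
     (\<forall>p. \<phi> p (\<xi> p) = 0) \<and>
     (\<forall>p. \<forall>x\<in>tangent_space A p. \<phi> p (\<phi> p x) = - x + tscale (\<eta> p x) (\<xi> p)) \<and>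
     (\<forall>p. \<forall>x\<in>tangent_space A p. \<eta> p (\<phi> p x) = 0) \<and>
     (\<forall>p. \<eta> p (\<xi> p) = 1) \<and>
     (\<forall>p. \<forall>x\<in>tangent_space A p. \<forall>y\<in>tangent_space A p.
        g p (\<phi> p x) (\<phi> p y) = - g p x y + \<eta> p x * \<eta> p y)"

definition associated_metric ::
  "('a, 'e) endo \<Rightarrow> ('a, 'e) form1 \<Rightarrow> ('a, 'e) form2 \<Rightarrow> ('a, 'e) form2" where
  "associated_metric \<phi> \<eta> g = (\<lambda>p x y. g p x (\<phi> p y) + \<eta> p x * \<eta> p y)"

text \<open>\<open>\<tau>\<close> is the scalar curvature of \<open>g\<close>, computed from its Levi-Civita connection \<open>D\<close>.\<close>
definition yamabe_almost_soliton ::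
  "('a, 'e::euclidean_space) chart set \<Rightarrow> ('a, 'e) form2 \<Rightarrow> ('a, 'e) conn
     \<Rightarrow> ('a, 'e) vfield \<Rightarrow> ('a \<Rightarrow> real) \<Rightarrow> bool" where
  "yamabe_almost_soliton A g D \<theta> l \<longleftrightarrow> smooth_vfield A \<theta> \<and> smooth_fun A l \<and>
     (\<forall>X Y p. smooth_vfield A X \<longrightarrow> smooth_vfield A Y \<longrightarrow>
        1 / 2 * lie_deriv2 A \<theta> g X Y p = (scalar_curvature A g D p - l p) * g p (X p) (Y p))"

definition vertical_potential ::
  "('a, 'e::euclidean_space) chart set \<Rightarrow> ('a, 'e) vfield \<Rightarrow> ('a \<Rightarrow> real) \<Rightarrow> ('a, 'e) vfield \<Rightarrow> bool" where
  "vertical_potential A \<xi> k \<theta> \<longleftrightarrow> smooth_fun A k \<and> (\<forall>p. k p \<noteq> 0) \<and> \<theta> = fscale k \<xi>"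

definition torse_forming ::
  "('a, 'e::euclidean_space) chart set \<Rightarrow> ('a, 'e) conn \<Rightarrow> ('a, 'e) vfield
     \<Rightarrow> ('a \<Rightarrow> real) \<Rightarrow> ('a, 'e) form1 \<Rightarrow> bool" where
  "torse_forming A D \<theta> f \<gamma> \<longleftrightarrow> smooth_vfield A \<theta> \<and> smooth_fun A f \<and> smooth_form1 A \<gamma> \<and>
     (\<forall>X p. smooth_vfield A X \<longrightarrow>
        D X \<theta> p = tscale (f p) (X p) + tscale (\<gamma> p (X p)) (\<theta> p))"

end

theory Submission
  imports Defs "HOL-Computational_Algebra.Polynomial"
begin

text \<open>Let \<open>g\<^sup>~\<close> be the associated metric. The Levi-Civita connection turns the Lie derivative of
  \<open>g\<^sup>~\<close> into the symmetrized covariant derivative of the potential \<open>\<theta> = k \<xi>\<close>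
  (\<open>lie_derivative_levi_civita\<close>), so for a torse-forming potential the soliton equation reads
  \<open>f g\<^sup>~(x,y) + (\<gamma>(x) g\<^sup>~(\<theta>,y) + \<gamma>(y) g\<^sup>~(\<theta>,x)) / 2 = (\<tau> - \<lambda>) g\<^sup>~(x,y)\<close>.
  Since \<open>g\<^sup>~(\<xi>,y) = \<eta>(y)\<close> (\<open>associated_metric_reeb\<close>), the terms with \<open>\<gamma>\<close> vanish when \<open>x\<close> and
  \<open>y\<close> lie in the contact hyperplane \<open>ker \<eta>\<close>. That hyperplane contains a pair with
  \<open>g\<^sup>~(x,y) \<noteq> 0\<close> (\<open>associated_metric_horizontal_nonzero\<close>), and dividing by this number gives
  \<open>f = \<tau> - \<lambda>\<close> at the point.

  The equations are about smooth vector fields, whereas the vectors \<open>x\<close> and \<open>y\<close> are found at a single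
  point. They are joined by \<open>tangent_vector_extends\<close>: every tangent vector is the value of a global
  smooth vector field, obtained by cutting off a field with constant components in a chart with a bump
  function. The calculus of \<open>C\<^sup>k\<close> maps and the function \<open>exp(-1/t)\<close> serve this purpose.\<close>

section \<open>Calculus of \<open>C\<^sup>k\<close> maps\<close>

lemma Ck_on_SucD: "Ck_on (Suc k) S f \<Longrightarrow> Ck_on k S f"
proof (induction k arbitrary: f)
  case 0
  then show ?case
    by (auto intro!: continuous_at_imp_continuous_on differentiable_imp_continuous_within)
next
  case (Suc k)
  then show ?case by simp
qed

lemma frechet_derivative_cong_open:
  assumes "open S" "x \<in> S" "\<And>y. y \<in> S \<Longrightarrow> f y = g y"
  shows "f differentiable (at x) \<longleftrightarrow> g differentiable (at x)"
    and "frechet_derivative f (at x) = frechet_derivative g (at x)"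
proof -
  have "(f has_derivative D) (at x) \<longleftrightarrow> (g has_derivative D) (at x)" for D
    using assms has_derivative_transform_within_open[of f D x UNIV S g]
      has_derivative_transform_within_open[of g D x UNIV S f] by auto
  then show "f differentiable (at x) \<longleftrightarrow> g differentiable (at x)"
    and "frechet_derivative f (at x) = frechet_derivative g (at x)"
    by (auto simp: differentiable_def frechet_derivative_def)
qed

lemma Ck_on_cong:
  assumes "Ck_on k S f" "open S" "\<And>x. x \<in> S \<Longrightarrow> f x = g x"
  shows "Ck_on k S g"
  using assms(1,3)
proof (induction k arbitrary: f g)
  case 0
  then show ?case by (simp cong: continuous_on_cong)
next
  case (Suc k)
  have d: "g differentiable (at x) \<longleftrightarrow> f differentiable (at x)"
      "frechet_derivative f (at x) = frechet_derivative g (at x)" if "x \<in> S" for x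
    using frechet_derivative_cong_open[OF assms(2) that, of f g] Suc.prems(2) by auto
  have "Ck_on k S (\<lambda>x. frechet_derivative g (at x) v)" for v
    using Suc.IH[of "\<lambda>x. frechet_derivative f (at x) v"] Suc.prems(1) d(2) by auto
  then show ?case using Suc.prems(1) d(1) by simp
qed

lemma Ck_on_Un:
  assumes "Ck_on k U f" "Ck_on k V f" "open U" "open V"
  shows "Ck_on k (U \<union> V) f"
  using assms by (induction k arbitrary: f) (auto intro: continuous_on_open_Un)

lemma Ck_on_const: "Ck_on k S (\<lambda>x. c)"
  by (induction k arbitrary: c) (auto simp: frechet_derivative_const)

lemma Ck_on_linear:
  assumes "bounded_linear f" shows "Ck_on k S f"
proof (cases k)
  case 0
  then show ?thesis using assms
    by (simp add: linear_continuous_on)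
next
  case (Suc j)
  have "frechet_derivative f (at x) = f" for x
    using assms by (simp add: bounded_linear_imp_has_derivative frechet_derivative_at[symmetric])
  then show ?thesis using assms Suc
    by (auto simp: Ck_on_const intro: bounded_linear_imp_differentiable)
qed

lemma Ck_on_add:
  assumes "open S" "Ck_on k S f" "Ck_on k S g"
  shows "Ck_on k S (\<lambda>x. f x + g x)"
  using assms(2,3)
proof (induction k arbitrary: f g)
  case 0
  then show ?case by (simp add: continuous_on_add)
next
  case (Suc k)
  have D: "((\<lambda>x. f x + g x) has_derivative
      (\<lambda>v. frechet_derivative f (at x) v + frechet_derivative g (at x) v)) (at x)" if "x \<in> S" for x
    using Suc.prems that
    by (intro has_derivative_add) (auto simp: frechet_derivative_works[symmetric])
  have "Ck_on k S (\<lambda>x. frechet_derivative (\<lambda>x. f x + g x) (at x) v)" for v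
  proof (rule Ck_on_cong[OF _ assms(1)])
    show "Ck_on k S (\<lambda>x. frechet_derivative f (at x) v + frechet_derivative g (at x) v)"
      using Suc by auto
    fix x assume "x \<in> S"
    from frechet_derivative_at[OF D[OF this], THEN fun_cong, of v]
    show "frechet_derivative f (at x) v + frechet_derivative g (at x) v
        = frechet_derivative (\<lambda>x. f x + g x) (at x) v" by simp
  qed
  then show ?case unfolding Ck_on.simps using differentiableI[OF D] by blast
qed

lemma Ck_on_sum:
  assumes "open S" "\<And>i. i \<in> I \<Longrightarrow> Ck_on k S (f i)"
  shows "Ck_on k S (\<lambda>x. \<Sum>i\<in>I. f i x)"
  using assms(2)
  by (induction I rule: infinite_finite_induct) (auto intro: Ck_on_const Ck_on_add assms(1))

text \<open>By the product rule the derivative of the product is a sum of two products of \<open>C\<^sup>k\<close> maps, so the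
  induction has to range over both factors.\<close>

lemma Ck_on_bilinear:
  assumes "bounded_bilinear B" "open S" "Ck_on k S f" "Ck_on k S g"
  shows "Ck_on k S (\<lambda>x. B (f x) (g x))"
  using assms(3,4)
proof (induction k arbitrary: f g)
  case 0
  then show ?case by (simp add: bounded_bilinear.continuous_on[OF assms(1)])
next
  case (Suc k)
  have D: "((\<lambda>x. B (f x) (g x)) has_derivative
      (\<lambda>v. B (f x) (frechet_derivative g (at x) v) + B (frechet_derivative f (at x) v) (g x)))
      (at x)" if "x \<in> S" for x
    using Suc.prems that
    by (intro bounded_bilinear.FDERIV[OF assms(1)]) (auto simp: frechet_derivative_works)
  have "Ck_on k S (\<lambda>x. frechet_derivative (\<lambda>x. B (f x) (g x)) (at x) v)" for v
  proof (rule Ck_on_cong[OF _ assms(2)])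
    show "Ck_on k S (\<lambda>x. B (f x) (frechet_derivative g (at x) v)
        + B (frechet_derivative f (at x) v) (g x))"
      using Suc.prems Ck_on_SucD[OF Suc.prems(1)] Ck_on_SucD[OF Suc.prems(2)]
      by (intro Ck_on_add assms(2) Suc.IH) auto
  next
    fix x assume "x \<in> S"
    from frechet_derivative_at[OF D[OF this], THEN fun_cong, of v]
    show "B (f x) (frechet_derivative g (at x) v) + B (frechet_derivative f (at x) v) (g x)
        = frechet_derivative (\<lambda>x. B (f x) (g x)) (at x) v" by simp
  qed
  then show ?case unfolding Ck_on.simps using differentiableI[OF D] by blast
qed

text \<open>The chain rule applies the derivative of \<open>f\<close> at \<open>g x\<close> to a vector that varies with \<open>x\<close>, which is not
  of a form the induction hypothesis covers. Expanding this vector in the standard basis writes the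
  derivative as a finite sum of \<open>C\<^sup>k\<close> scalars times partial derivatives of \<open>f\<close> composed with \<open>g\<close>.\<close>

lemma Ck_on_compose:
  fixes f :: "'d::euclidean_space \<Rightarrow> 'c::real_normed_vector" and g :: "'e::euclidean_space \<Rightarrow> 'd"
  assumes "open S" "Ck_on k S g" "Ck_on k T f" "g ` S \<subseteq> T"
  shows "Ck_on k S (f \<circ> g)"
  using assms(2,3)
proof (induction k arbitrary: f)
  case 0
  then show ?case using assms(4)
    by (simp add: continuous_on_compose continuous_on_subset del: comp_apply)
next
  case (Suc k)
  have D: "(f \<circ> g has_derivative
      frechet_derivative f (at (g x)) \<circ> frechet_derivative g (at x)) (at x)" if "x \<in> S" for x
    using Suc.prems that assms(4)
    by (intro diff_chain_at) (auto simp: frechet_derivative_works[symmetric])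
  have "Ck_on k S (\<lambda>x. frechet_derivative (f \<circ> g) (at x) v)" for v
  proof (rule Ck_on_cong[OF _ assms(1)])
    show "Ck_on k S (\<lambda>x. \<Sum>b\<in>Basis. (frechet_derivative g (at x) v \<bullet> b) *\<^sub>R
        ((\<lambda>y. frechet_derivative f (at y) b) \<circ> g) x)"
      using Suc.prems
      by (intro Ck_on_sum Ck_on_bilinear[OF bounded_bilinear_scaleR]
          Ck_on_bilinear[OF bounded_bilinear_inner] Ck_on_const Suc.IH Ck_on_SucD[of k S g] assms(1))
        auto
  next
    fix x assume x: "x \<in> S"
    then have "bounded_linear (frechet_derivative f (at (g x)))"
      using Suc.prems assms(4) by (auto intro!: has_derivative_bounded_linear[of f _ "at (g x)"]
          simp: frechet_derivative_works[symmetric])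
    then have lin: "linear (frechet_derivative f (at (g x)))" by (rule bounded_linear.linear)
    have "frechet_derivative (f \<circ> g) (at x) v
        = frechet_derivative f (at (g x)) (frechet_derivative g (at x) v)"
      using frechet_derivative_at[OF D[OF x]] by (metis comp_apply)
    also have "\<dots> = frechet_derivative f (at (g x))
        (\<Sum>b\<in>Basis. (frechet_derivative g (at x) v \<bullet> b) *\<^sub>R b)"
      by (simp add: euclidean_representation)
    finally show "(\<Sum>b\<in>Basis. (frechet_derivative g (at x) v \<bullet> b) *\<^sub>R
        ((\<lambda>y. frechet_derivative f (at y) b) \<circ> g) x) = frechet_derivative (f \<circ> g) (at x) v"
      by (simp add: linear_sum[OF lin] linear_scale[OF lin])
  qed
  then show ?case unfolding Ck_on.simps using differentiableI[OF D] by blast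
qed

section \<open>Bump functions\<close>

text \<open>The factor \<open>P(1/t)\<close> makes the family closed under differentiation: all derivatives of the function
  for \<open>P = 1\<close>, which is \<open>exp(-1/t)\<close>, are again of this form.\<close>

definition flat_exp :: "real poly \<Rightarrow> real \<Rightarrow> real" where
  "flat_exp P t = (if t > 0 then poly P (1 / t) * exp (- (1 / t)) else 0)"

text \<open>With \<open>s = 1/t\<close> this says that \<open>exp s\<close> grows faster than every polynomial.\<close>

lemma flat_exp_tendsto_0: "(flat_exp P \<longlongrightarrow> 0) (at 0)"
proof (rule filterlim_split_at)
  have "((\<lambda>s. \<Sum>i\<le>degree P. coeff P i * (s ^ i / exp s)) \<longlongrightarrow> (\<Sum>i\<le>degree P. coeff P i * 0)) at_top"
    by (intro tendsto_intros tendsto_power_div_exp_0)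
  then have "((\<lambda>s. poly P s * exp (- s)) \<longlongrightarrow> 0) at_top"
    by (simp add: poly_altdef exp_minus sum_distrib_right divide_inverse mult.assoc)
  then have "((\<lambda>t. poly P (inverse t) * exp (- inverse t)) \<longlongrightarrow> 0) (at_right 0)"
    by (rule filterlim_compose[OF _ filterlim_inverse_at_top_right])
  then show "(flat_exp P \<longlongrightarrow> 0) (at_right 0)"
    by (rule Lim_transform_eventually)
      (auto simp: eventually_at_right_less flat_exp_def divide_inverse
        intro!: eventually_mono[OF eventually_at_right_less])
  show "(flat_exp P \<longlongrightarrow> 0) (at_left 0)"
    by (rule Lim_transform_eventually[OF tendsto_const])
      (auto simp: flat_exp_def eventually_at_left_field intro!: exI[of _ "-1"])
qed

lemma flat_exp_has_derivative:
  "(flat_exp P has_field_derivative flat_exp ([:0, 0, 1:] * (P - pderiv P)) t) (at t)"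
proof (cases t "0 :: real" rule: linorder_cases)
  case less
  have "((\<lambda>_. 0) has_field_derivative 0) (at t)" by simp
  then have "(flat_exp P has_field_derivative 0) (at t)"
    by (rule has_field_derivative_transform_within_open[of _ _ _ "{..<0}"])
      (use less in \<open>auto simp: flat_exp_def\<close>)
  then show ?thesis using less by (simp add: flat_exp_def)
next
  case equal
  (* Dividing by h is multiplying the polynomial by its variable: pCons 0 P evaluates at 1/h to P(1/h)/h. *)
  have "((\<lambda>h. flat_exp P h / h) \<longlongrightarrow> 0) (at 0)"
    by (rule Lim_transform_eventually[OF flat_exp_tendsto_0[of "pCons 0 P"]])
      (auto simp: flat_exp_def eventually_at_filter)
  then show ?thesis using equal by (simp add: DERIV_def flat_exp_def)
next
  case greater
  have "((\<lambda>t. poly P (1 / t) * exp (- (1 / t))) has_field_derivative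
      flat_exp ([:0, 0, 1:] * (P - pderiv P)) t) (at t)"
    using greater
    by (auto intro!: derivative_eq_intros DERIV_chain2[OF poly_DERIV]
        simp: flat_exp_def field_simps power2_eq_square)
  then show ?thesis
    by (rule has_field_derivative_transform_within_open[of _ _ _ "{0<..}"])
      (use greater in \<open>auto simp: flat_exp_def\<close>)
qed

lemma Ck_on_flat_exp: "Ck_on k UNIV (flat_exp P)"
proof (induction k arbitrary: P)
  case 0
  show ?case using flat_exp_has_derivative
    by (auto intro!: DERIV_continuous_on)
next
  case (Suc k)
  let ?Q = "[:0, 0, 1:] * (P - pderiv P)"
  have D: "(flat_exp P has_derivative (\<lambda>v. flat_exp ?Q t * v)) (at t)" for t
    using flat_exp_has_derivative by (rule has_field_derivative_imp_has_derivative)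
  have "Ck_on k UNIV (\<lambda>t. flat_exp ?Q t * v)" for v
    by (rule Ck_on_bilinear[OF bounded_bilinear_mult open_UNIV Suc.IH Ck_on_const])
  then have "Ck_on k UNIV (\<lambda>t. frechet_derivative (flat_exp P) (at t) v)" for v
    by (simp only: frechet_derivative_at[OF D, symmetric])
  then show ?case unfolding Ck_on.simps using differentiableI[OF D] by blast
qed

text \<open>The bump is \<open>exp(-1/t)\<close> at \<open>t = r\<^sup>2 - |x - c|\<^sup>2\<close>, scaled to be 1 at the centre. Taking the squared norm
  keeps the argument smooth at \<open>c\<close>.\<close>

lemma smooth_bump:
  fixes c :: "'e::euclidean_space"
  assumes "r > 0"
  shows "\<exists>\<beta> :: 'e \<Rightarrow> real. (\<forall>k. Ck_on k UNIV \<beta>) \<and> \<beta> c = 1 \<and> (\<forall>x. x \<notin> cball c r \<longrightarrow> \<beta> x = 0)"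
proof (intro exI conjI allI impI)
  let ?q = "\<lambda>x. r\<^sup>2 + - 1 * ((x - c) \<bullet> (x - c))"
  let ?h = "flat_exp [:1:]"
  let ?b = "\<lambda>x. (?h \<circ> ?q) x * (1 / ?h (r\<^sup>2))"
  have pos: "?h (r\<^sup>2) > 0" using assms by (simp add: flat_exp_def)
  show "Ck_on k UNIV ?b" for k
  proof -
    have lin: "Ck_on k UNIV (\<lambda>x. x - c)"
      using Ck_on_add[OF open_UNIV Ck_on_linear[OF bounded_linear_ident] Ck_on_const[of k UNIV "- c"]]
      by simp
    have "Ck_on k UNIV (\<lambda>x. (x - c) \<bullet> (x - c))"
      by (rule Ck_on_bilinear[OF bounded_bilinear_inner open_UNIV lin lin])
    from Ck_on_bilinear[OF bounded_bilinear_mult open_UNIV Ck_on_const[of k UNIV "- 1"] this]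
    have q: "Ck_on k UNIV ?q" by (intro Ck_on_add Ck_on_const) auto
    have "Ck_on k UNIV (?h \<circ> ?q)"
      by (rule Ck_on_compose[OF open_UNIV q Ck_on_flat_exp]) simp
    then show ?thesis
      by (rule Ck_on_bilinear[OF bounded_bilinear_mult open_UNIV _ Ck_on_const])
  qed
  show "?b c = 1" using pos by simp
  fix x assume "x \<notin> cball c r"
  then have "r < norm (x - c)" by (simp add: dist_norm norm_minus_commute)
  then have "r\<^sup>2 < (x - c) \<bullet> (x - c)"
    using assms by (metis power2_norm_eq_inner power_strict_mono less_imp_le pos2)
  then show "?b x = 0" by (simp add: flat_exp_def)
qed

section \<open>Tangent vectors and their extension to vector fields\<close>

lemma smooth_atlas_cinv_cmap:
  assumes "smooth_atlas A" "K \<in> A" "q \<in> cdom K"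
  shows "cinv K (cmap K q) = q"
  using assms by (auto simp: smooth_atlas_def is_chart_def homeomorphism_def)

lemma smooth_atlas_open_image:
  assumes "smooth_atlas A" "K \<in> A" "open U" "U \<subseteq> cdom K"
  shows "open (cmap K ` U)"
proof -
  have h: "homeomorphism (cdom K) (cmap K ` cdom K) (cmap K) (cinv K)" "open (cmap K ` cdom K)"
    using assms by (auto simp: smooth_atlas_def is_chart_def)
  have "openin (top_of_set (cdom K)) U" using assms(3,4) by (auto simp: openin_open)
  then have "openin (top_of_set (cmap K ` cdom K)) (cmap K ` U)"
    by (rule homeomorphism_imp_open_map[OF h(1)])
  then show ?thesis using h(2) openin_open_trans by blast
qed

lemma smooth_atlas_open_cdom: "smooth_atlas A \<Longrightarrow> K \<in> A \<Longrightarrow> open (cdom K)"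
  by (auto simp: smooth_atlas_def is_chart_def)

lemma transition_has_derivative:
  assumes "smooth_atlas A" "K \<in> A" "L \<in> A" "q \<in> cdom K" "q \<in> cdom L"
  shows "(cmap L \<circ> cinv K has_derivative frechet_derivative (cmap L \<circ> cinv K) (at (cmap K q)))
    (at (cmap K q))"
proof -
  have "Ck_on (Suc 0) (cmap K ` (cdom K \<inter> cdom L)) (cmap L \<circ> cinv K)"
    using assms unfolding smooth_atlas_def smooth_on_def by blast
  then have "cmap L \<circ> cinv K differentiable (at (cmap K q))" using assms(4,5) by auto
  then show ?thesis by (simp only: frechet_derivative_works)
qed

text \<open>The cocycle rule for coordinate changes: it is what makes components that are given in one chart and
  carried to all others by the Jacobian a tangent vector.\<close>

lemma transition_derivative_chain:
  assumes A: "smooth_atlas A" "K \<in> A" "L \<in> A" "M \<in> A" and q: "q \<in> cdom K" "q \<in> cdom L" "q \<in> cdom M"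
  shows "frechet_derivative (cmap M \<circ> cinv K) (at (cmap K q)) w =
    frechet_derivative (cmap M \<circ> cinv L) (at (cmap L q))
      (frechet_derivative (cmap L \<circ> cinv K) (at (cmap K q)) w)"
proof -
  let ?U = "cdom K \<inter> cdom L \<inter> cdom M"
  have "(cmap M \<circ> cinv L has_derivative frechet_derivative (cmap M \<circ> cinv L) (at (cmap L q)))
      (at ((cmap L \<circ> cinv K) (cmap K q)))"
    using transition_has_derivative[OF A(1,3,4) q(2,3)] smooth_atlas_cinv_cmap[OF A(1,2) q(1)] by simp
  from diff_chain_at[OF transition_has_derivative[OF A(1-3) q(1,2)] this]
  have "(cmap M \<circ> cinv K has_derivative frechet_derivative (cmap M \<circ> cinv L) (at (cmap L q))
      \<circ> frechet_derivative (cmap L \<circ> cinv K) (at (cmap K q))) (at (cmap K q))"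
  proof (rule has_derivative_transform_within_open)
    show "open (cmap K ` ?U)"
      using A by (intro smooth_atlas_open_image[OF A(1,2)] open_Int smooth_atlas_open_cdom) auto
    show "cmap K q \<in> cmap K ` ?U" using q by auto
    fix x assume "x \<in> cmap K ` ?U"
    then show "((cmap M \<circ> cinv L) \<circ> (cmap L \<circ> cinv K)) x = (cmap M \<circ> cinv K) x"
      using smooth_atlas_cinv_cmap[OF A(1)] A by auto
  qed
  from frechet_derivative_at[OF this] show ?thesis by (metis comp_apply)
qed

lemma tangent_spaceI:
  assumes "\<And>K. K \<notin> charts_at A p \<Longrightarrow> v K = 0"
    and "\<And>K L. K \<in> charts_at A p \<Longrightarrow> L \<in> charts_at A p \<Longrightarrow>
      v L = frechet_derivative (cmap L \<circ> cinv K) (at (cmap K p)) (v K)"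
  shows "v \<in> tangent_space A p"
  unfolding tangent_space_def
  by (intro CollectI conjI allI ballI impI) (fact assms)+

text \<open>The transformation law expresses \<open>v L\<close> by \<open>v K\<close> and conversely, so as a rewrite rule it must be
  oriented towards removing the Jacobian.\<close>

lemma tangent_spaceD:
  assumes "v \<in> tangent_space A p"
  shows "K \<notin> charts_at A p \<Longrightarrow> v K = 0"
    and "K \<in> charts_at A p \<Longrightarrow> L \<in> charts_at A p \<Longrightarrow>
      frechet_derivative (cmap L \<circ> cinv K) (at (cmap K p)) (v K) = v L"
proof -
  have "(\<forall>K. K \<notin> charts_at A p \<longrightarrow> v K = 0) \<and> (\<forall>K\<in>charts_at A p. \<forall>L\<in>charts_at A p.
      v L = frechet_derivative (cmap L \<circ> cinv K) (at (cmap K p)) (v K))"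
    using assms unfolding tangent_space_def by (rule CollectD)
  then show "K \<notin> charts_at A p \<Longrightarrow> v K = 0"
    and "K \<in> charts_at A p \<Longrightarrow> L \<in> charts_at A p \<Longrightarrow>
      frechet_derivative (cmap L \<circ> cinv K) (at (cmap K p)) (v K) = v L"
    by metis+
qed

lemma transition_linear:
  assumes "smooth_atlas A" "K \<in> charts_at A p" "L \<in> charts_at A p"
  shows "linear (frechet_derivative (cmap L \<circ> cinv K) (at (cmap K p)))"
  using transition_has_derivative[OF assms(1), of K L p] assms(2,3)
  by (auto simp: charts_at_def intro: has_derivative_linear)

text \<open>In a chart \<open>K\<close> around \<open>p\<close> the extension has constant components \<open>v K\<close> times a bump function, and it
  is 0 outside the domain of \<open>K\<close>. The support of the bump corresponds to a compact set \<open>C\<close> in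
  the domain of \<open>K\<close>; as the manifold is Hausdorff, \<open>C\<close> is closed. Hence the domain of every chart is
  covered by two open sets, one inside the domain of \<open>K\<close>, where the components are a \<open>C\<^sup>k\<close> scalar times the
  Jacobian, and one off \<open>C\<close>, where they vanish.\<close>

lemma tangent_vector_extends:
  fixes A :: "('a::{t2_space, second_countable_topology}, 'e::euclidean_space) chart set"
  assumes A: "smooth_atlas A" and v: "v \<in> tangent_space A p"
  obtains X where "smooth_vfield A X" "X p = v"
proof -
  obtain K where K: "K \<in> A" "p \<in> cdom K"
    using A unfolding smooth_atlas_def by blast
  let ?T = "\<lambda>L M. cmap M \<circ> cinv L"
  let ?J = "\<lambda>M. \<lambda>x. frechet_derivative (?T K M) (at x) (v K)"
  have hom: "homeomorphism (cdom K) (cmap K ` cdom K) (cmap K) (cinv K)"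
    and op: "open (cmap K ` cdom K)"
    using A K by (auto simp: smooth_atlas_def is_chart_def)
  obtain r where r: "r > 0" "cball (cmap K p) r \<subseteq> cmap K ` cdom K"
    using op K open_contains_cball by blast
  obtain \<beta> :: "'e \<Rightarrow> real" where \<beta>: "\<And>k. Ck_on k UNIV \<beta>" "\<beta> (cmap K p) = 1"
      "\<And>x. x \<notin> cball (cmap K p) r \<Longrightarrow> \<beta> x = 0"
    using smooth_bump[OF r(1), of "cmap K p"] by blast
  define C where "C = cinv K ` cball (cmap K p) r"
  have "compact C" unfolding C_def using hom r(2)
    by (intro compact_continuous_image) (auto simp: homeomorphism_def intro: continuous_on_subset)
  then have "closed C" by (rule compact_imp_closed)
  have "C \<subseteq> cdom K" 
    using image_mono[OF r(2), of "cinv K"] by (simp only: C_def homeomorphism_image2[OF hom])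
  have C: "\<beta> (cmap K q) = 0" if "q \<in> cdom K" "q \<notin> C" for q
    using \<beta>(3)[of "cmap K q"] that smooth_atlas_cinv_cmap[OF A K(1)] by (force simp: C_def)
  define X where "X = (\<lambda>q L. if q \<in> cdom K \<and> L \<in> charts_at A q
    then \<beta> (cmap K q) *\<^sub>R ?J L (cmap K q) else 0)"
  have "X q \<in> tangent_space A q" for q
  proof (rule tangent_spaceI)
    fix L M assume LM: "L \<in> charts_at A q" "M \<in> charts_at A q"
    have lin: "linear (frechet_derivative (?T L M) (at (cmap L q)))"
      by (rule transition_linear[OF A LM])
    then show "X q M = frechet_derivative (?T L M) (at (cmap L q)) (X q L)"
      using transition_derivative_chain[OF A K(1), of L M q "v K"] LM
      by (auto simp: X_def charts_at_def linear_0 linear_scale)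
  qed (simp add: X_def)
  moreover have "smooth_on (cmap L ` cdom L) (comp_in L X)" if L: "L \<in> A" for L
    unfolding smooth_on_def
  proof
    fix k
    note inv = smooth_atlas_cinv_cmap[OF A L]
    let ?U = "cmap L ` (cdom L \<inter> cdom K)" and ?V = "cmap L ` (cdom L - C)"
    have U: "open ?U" and V: "open ?V"
      using \<open>closed C\<close> by (auto intro!: smooth_atlas_open_image[OF A L] open_Diff open_Int
          smooth_atlas_open_cdom[OF A] L K)
    have T: "Ck_on k ?U (?T L K)" and S: "smooth_on (cmap K ` (cdom K \<inter> cdom L)) (?T K L)"
      using A L K by (auto simp: smooth_atlas_def smooth_on_def)
    have "Ck_on (Suc k) (cmap K ` (cdom K \<inter> cdom L)) (?T K L)"
      using S by (simp only: smooth_on_def)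
    then have J: "Ck_on k (cmap K ` (cdom K \<inter> cdom L)) (?J L)" by simp
    have "Ck_on k ?U (\<lambda>x. (\<beta> \<circ> ?T L K) x *\<^sub>R (?J L \<circ> ?T L K) x)"
      using inv by (intro Ck_on_bilinear[OF bounded_bilinear_scaleR U]
          Ck_on_compose[OF U T \<beta>(1)] Ck_on_compose[OF U T J]) auto
    then have "Ck_on k ?U (comp_in L X)"
      by (rule Ck_on_cong[OF _ U]) (use inv L in \<open>auto simp: comp_in_def X_def charts_at_def\<close>)
    moreover have "Ck_on k ?V (comp_in L X)"
      by (rule Ck_on_cong[OF Ck_on_const[of k ?V 0] V]) (use inv L C in \<open>auto simp: comp_in_def X_def\<close>)
    moreover have "cmap L ` cdom L = ?U \<union> ?V" using \<open>C \<subseteq> cdom K\<close> by blast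
    ultimately show "Ck_on k (cmap L ` cdom L) (comp_in L X)"
      using Ck_on_Un U V by metis
  qed
  ultimately have "smooth_vfield A X" by (simp add: smooth_vfield_def)
  moreover have "X p = v"
  proof
    fix L show "X p L = v L"
    proof (cases "L \<in> charts_at A p")
      case True
      moreover have "K \<in> charts_at A p" using K by (simp add: charts_at_def)
      ultimately have "?J L (cmap K p) = v L" using True by (intro tangent_spaceD[OF v])
      then show ?thesis using True K \<beta>(2) by (simp add: X_def)
    next
      case False
      then show ?thesis using tangent_spaceD(1)[OF v] by (simp add: X_def)
    qed
  qed
  ultimately show thesis by (rule that)
qed

lemma tangent_space_add:
  assumes A: "smooth_atlas A" and v: "v \<in> tangent_space A p" and w: "w \<in> tangent_space A p"
  shows "v + w \<in> tangent_space A p"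
proof (rule tangent_spaceI)
  fix K assume "K \<notin> charts_at A p"
  then show "(v + w) K = 0" using tangent_spaceD(1)[OF v] tangent_spaceD(1)[OF w] by simp
next
  fix K L assume KL: "K \<in> charts_at A p" "L \<in> charts_at A p"
  show "(v + w) L = frechet_derivative (cmap L \<circ> cinv K) (at (cmap K p)) ((v + w) K)"
    unfolding plus_fun_apply linear_add[OF transition_linear[OF A KL]]
      tangent_spaceD(2)[OF v KL] tangent_spaceD(2)[OF w KL] ..
qed

lemma tangent_space_scale:
  assumes A: "smooth_atlas A" and v: "v \<in> tangent_space A p"
  shows "tscale a v \<in> tangent_space A p"
proof (rule tangent_spaceI)
  fix K assume "K \<notin> charts_at A p"
  then show "tscale a v K = 0" using tangent_spaceD(1)[OF v] by (simp add: tscale_def)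
next
  fix K L assume KL: "K \<in> charts_at A p" "L \<in> charts_at A p"
  show "tscale a v L = frechet_derivative (cmap L \<circ> cinv K) (at (cmap K p)) (tscale a v K)"
    unfolding tscale_def linear_scale[OF transition_linear[OF A KL]] tangent_spaceD(2)[OF v KL] ..
qed

lemma uminus_eq_tscale: "- v = tscale (- 1) v" and tscale_0: "tscale 0 v = 0"
  by (auto simp: tscale_def fun_eq_iff)

lemma tangent_space_diff:
  assumes "smooth_atlas A" "v \<in> tangent_space A p" "w \<in> tangent_space A p"
  shows "v - w \<in> tangent_space A p"
  using tangent_space_add[OF assms(1,2) tangent_space_scale[OF assms(1,3), of "- 1"]]
  by (simp add: uminus_eq_tscale[symmetric])

section \<open>The Lie derivative of a metric\<close>

text \<open>Metric compatibility expands \<open>T(h(X,Y))\<close>, and torsion-freeness replaces \<open>D\<^sub>T X\<close> by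
  \<open>[T,X] + D\<^sub>X T\<close>; the brackets then cancel against those in the Lie derivative.\<close>

lemma lie_derivative_levi_civita:
  assumes A: "smooth_atlas A" and D: "levi_civita A h D"
    and sm: "smooth_vfield A T" "smooth_vfield A X" "smooth_vfield A Y"
    and add: "\<And>u v w. \<lbrakk>u \<in> tangent_space A p; v \<in> tangent_space A p; w \<in> tangent_space A p\<rbrakk>
      \<Longrightarrow> h p (u + v) w = h p u w + h p v w"
    and sym: "\<And>u v. \<lbrakk>u \<in> tangent_space A p; v \<in> tangent_space A p\<rbrakk> \<Longrightarrow> h p u v = h p v u"
  shows "lie_deriv2 A T h X Y p = h p (D X T p) (Y p) + h p (X p) (D Y T p)"
proof -
  have tan: "Z p \<in> tangent_space A p" if "smooth_vfield A Z" for Z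
    using that by (simp add: smooth_vfield_def)
  have smD: "smooth_vfield A (D U V)" if "smooth_vfield A U" "smooth_vfield A V" for U V
    using D that unfolding levi_civita_def affine_connection_def by blast
  have torsion_free: "\<forall>X Y. smooth_vfield A X \<longrightarrow> smooth_vfield A Y \<longrightarrow>
      D X Y - D Y X = bracket A X Y"
    and metric: "\<forall>X Y Z p. smooth_vfield A X \<longrightarrow> smooth_vfield A Y \<longrightarrow> smooth_vfield A Z \<longrightarrow>
      dir_deriv A p (X p) (\<lambda>q. h q (Y q) (Z q)) = h p (D X Y p) (Z p) + h p (Y p) (D X Z p)"
    using D unfolding levi_civita_def by - (elim conjE, assumption)+
  have br: "bracket A T Z p \<in> tangent_space A p" "D T Z p = bracket A T Z p + D Z T p"
    if "smooth_vfield A Z" for Z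
  proof -
    have "D T Z - D Z T = bracket A T Z" using torsion_free sm(1) that by blast
    from fun_cong[OF this, of p] have eq: "bracket A T Z p = D T Z p - D Z T p" by simp
    show "bracket A T Z p \<in> tangent_space A p"
      unfolding eq using sm(1) that by (intro tangent_space_diff A tan smD)
    show "D T Z p = bracket A T Z p + D Z T p" by (simp add: eq)
  qed
  have split: "h p (D T Z p) w = h p (bracket A T Z p) w + h p (D Z T p) w"
    if "smooth_vfield A Z" "w \<in> tangent_space A p" for Z w
    unfolding br(2)[OF that(1)] 
    by (rule add[OF br(1)[OF that(1)] tan[OF smD[OF that(1) sm(1)]] that(2)])
  have split': "h p w (D T Z p) = h p w (bracket A T Z p) + h p w (D Z T p)"
    if "smooth_vfield A Z" "w \<in> tangent_space A p" for Z w
  proof -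
    have "D T Z p \<in> tangent_space A p" "D Z T p \<in> tangent_space A p"
      using that(1) sm(1) by (simp_all add: tan smD)
    then show ?thesis
      using split[OF that] sym[OF that(2)] br(1)[OF that(1)] by simp
  qed
  have "dir_deriv A p (T p) (\<lambda>q. h q (X q) (Y q)) = h p (D T X p) (Y p) + h p (X p) (D T Y p)"
    using metric sm by blast
  then show ?thesis
    unfolding lie_deriv2_def using split[OF sm(2) tan[OF sm(3)]] split'[OF sm(3) tan[OF sm(2)]]
    by simp
qed

section \<open>The associated B-metric\<close>

locale accR =
  fixes n :: nat and A :: "('a::{t2_space, second_countable_topology}, 'e::euclidean_space) chart set"
    and \<phi> :: "('a, 'e) endo" and \<xi> :: "('a, 'e) vfield" and \<eta> :: "('a, 'e) form1"
    and g :: "('a, 'e) form2"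
  assumes accR: "accR_manifold n A \<phi> \<xi> \<eta> g"
begin

abbreviation "gt \<equiv> associated_metric \<phi> \<eta> g"

lemma atlas: "smooth_atlas A" and endo: "smooth_endo A \<phi>" and reeb: "smooth_vfield A \<xi>"
  and form: "smooth_form1 A \<eta>" and metric: "pseudo_riemannian_metric A g"
  and signature: "has_signature A g (n + 1) n" and n_pos: "n \<ge> 1"
  using accR unfolding accR_manifold_def by - (elim conjE, assumption)+

lemma reeb_tangent: "\<xi> p \<in> tangent_space A p"
  using reeb by (simp add: smooth_vfield_def)

lemma phi_tangent [rule_format]: "\<forall>p. \<forall>v\<in>tangent_space A p. \<phi> p v \<in> tangent_space A p"
  using endo unfolding smooth_endo_def by (elim conjE)

lemma phi_reeb [rule_format]: "\<forall>p. \<phi> p (\<xi> p) = 0"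
  and phi_phi [rule_format]:
    "\<forall>p. \<forall>x\<in>tangent_space A p. \<phi> p (\<phi> p x) = - x + tscale (\<eta> p x) (\<xi> p)"
  and eta_phi [rule_format]: "\<forall>p. \<forall>x\<in>tangent_space A p. \<eta> p (\<phi> p x) = 0"
  and eta_reeb [rule_format]: "\<forall>p. \<eta> p (\<xi> p) = 1"
  and metric_phi [rule_format]: "\<forall>p. \<forall>x\<in>tangent_space A p. \<forall>y\<in>tangent_space A p.
    g p (\<phi> p x) (\<phi> p y) = - g p x y + \<eta> p x * \<eta> p y"
  using accR unfolding accR_manifold_def by - (elim conjE, assumption)+

lemma eta_add [rule_format]:
    "\<forall>p. \<forall>v\<in>tangent_space A p. \<forall>w\<in>tangent_space A p. \<eta> p (v + w) = \<eta> p v + \<eta> p w"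
  and eta_scale [rule_format]:
    "\<forall>p a. \<forall>v\<in>tangent_space A p. \<eta> p (tscale a v) = a * \<eta> p v"
  using form unfolding smooth_form1_def by - (elim conjE, assumption)+

lemma metric_add [rule_format]: "\<forall>p. \<forall>u\<in>tangent_space A p. \<forall>v\<in>tangent_space A p.
    \<forall>w\<in>tangent_space A p. g p (u + v) w = g p u w + g p v w"
  and metric_scale [rule_format]: "\<forall>p a. \<forall>v\<in>tangent_space A p. \<forall>w\<in>tangent_space A p.
    g p (tscale a v) w = a * g p v w"
  and metric_sym [rule_format]: "\<forall>p. \<forall>v\<in>tangent_space A p. \<forall>w\<in>tangent_space A p.
    g p v w = g p w v"
  and metric_nondegenerate [rule_format]: "\<forall>p. \<forall>v\<in>tangent_space A p.
    (\<forall>w\<in>tangent_space A p. g p v w = 0) \<longrightarrow> v = 0"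
  using metric unfolding pseudo_riemannian_metric_def by - (elim conjE, assumption)+

text \<open>Compatibility of \<open>g\<close> with \<open>\<phi>\<close>, applied to \<open>\<xi>\<close> and \<open>\<phi> v\<close>: the left-hand side vanishes since
  \<open>\<phi> \<xi> = 0\<close>, and so does the product of the values of \<open>\<eta>\<close> since \<open>\<eta> \<circ> \<phi> = 0\<close>.\<close>

lemma reeb_orthogonal_phi:
  assumes "v \<in> tangent_space A p"
  shows "g p (\<xi> p) (\<phi> p v) = 0"
proof -
  have "g p 0 (\<phi> p (\<phi> p v)) = 0"
    using metric_scale[OF reeb_tangent phi_tangent[OF phi_tangent[OF assms]], of 0]
    by (simp add: tscale_0)
  then show ?thesis
    using metric_phi[OF reeb_tangent phi_tangent[OF assms]] by (simp add: phi_reeb eta_phi assms)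
qed

text \<open>By \<open>\<phi>\<^sup>2 = -Id + \<eta> \<otimes> \<xi>\<close>; the term with \<open>\<xi>\<close> drops out because \<open>\<xi>\<close> is orthogonal to the image of \<open>\<phi>\<close>.\<close>

lemma metric_phi_phi:
  assumes x: "x \<in> tangent_space A p" and y: "y \<in> tangent_space A p"
  shows "g p (\<phi> p x) (\<phi> p (\<phi> p y)) = - g p (\<phi> p x) y"
proof -
  note \<phi>x = phi_tangent[OF x]
  have "g p (\<phi> p (\<phi> p y)) (\<phi> p x) = - g p y (\<phi> p x) + \<eta> p y * g p (\<xi> p) (\<phi> p x)"
    unfolding phi_phi[OF y] uminus_eq_tscale[of y]
      metric_add[OF tangent_space_scale[OF atlas y] tangent_space_scale[OF atlas reeb_tangent] \<phi>x]
      metric_scale[OF y \<phi>x] metric_scale[OF reeb_tangent \<phi>x] by simp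
  then show ?thesis
    using metric_sym[OF \<phi>x y] metric_sym[OF \<phi>x phi_tangent[OF phi_tangent[OF y]]]
    by (simp only: reeb_orthogonal_phi[OF x] mult_zero_right add_0_right)
qed

text \<open>Two evaluations of \<open>g(\<phi> x, \<phi> \<phi> y)\<close> are compared, one by compatibility of \<open>g\<close> with \<open>\<phi>\<close>, the other by
  \<open>metric_phi_phi\<close>. This self-adjointness is the symmetry of the associated metric.\<close>

lemma phi_self_adjoint:
  assumes x: "x \<in> tangent_space A p" and y: "y \<in> tangent_space A p"
  shows "g p x (\<phi> p y) = g p y (\<phi> p x)"
  using metric_phi[OF x phi_tangent[OF y], unfolded eta_phi[OF y]] metric_phi_phi[OF x y]
    metric_sym[OF y phi_tangent[OF x]]
  by linarith

lemma associated_metric_sym: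
  "x \<in> tangent_space A p \<Longrightarrow> y \<in> tangent_space A p \<Longrightarrow> gt p x y = gt p y x"
  unfolding associated_metric_def using phi_self_adjoint[of x p y] by simp

lemma associated_metric_add:
  assumes "x \<in> tangent_space A p" "y \<in> tangent_space A p" "z \<in> tangent_space A p"
  shows "gt p (x + y) z = gt p x z + gt p y z"
  unfolding associated_metric_def metric_add[OF assms(1,2) phi_tangent[OF assms(3)]]
    eta_add[OF assms(1,2)] distrib_right by (simp only: ac_simps)

lemma associated_metric_scale:
  assumes "x \<in> tangent_space A p" "z \<in> tangent_space A p"
  shows "gt p (tscale a x) z = a * gt p x z"
  unfolding associated_metric_def metric_scale[OF assms(1) phi_tangent[OF assms(2)]]
    eta_scale[OF assms(1)] distrib_left by (simp only: ac_simps)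

lemma associated_metric_reeb:
  assumes "y \<in> tangent_space A p"
  shows "gt p (\<xi> p) y = \<eta> p y"
  using reeb_orthogonal_phi[OF assms] by (simp add: associated_metric_def eta_reeb)

text \<open>Otherwise \<open>\<phi>\<^sup>2 = -Id + \<eta> \<otimes> \<xi>\<close> would make every tangent vector a multiple of \<open>\<xi>\<close>. But \<open>n \<ge> 1\<close> and the
  signature provide two orthogonal vectors of length 1, which cannot be proportional.\<close>

lemma phi_nonzero: "\<exists>v\<in>tangent_space A p. \<phi> p v \<noteq> 0"
proof (rule ccontr)
  assume "\<not> ?thesis"
  then have \<phi>0: "\<phi> p v = 0" if "v \<in> tangent_space A p" for v using that by blast
  have line: "v = tscale (\<eta> p v) (\<xi> p)" if "v \<in> tangent_space A p" for v
    using minus_unique[OF phi_phi[OF that, unfolded \<phi>0[OF phi_tangent[OF that]], symmetric]]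
    unfolding minus_minus .
  have g: "g p v w = \<eta> p v * g p (\<xi> p) w" if "v \<in> tangent_space A p" "w \<in> tangent_space A p" for v w
    using metric_scale[OF reeb_tangent that(2), of "\<eta> p v"]
    by (simp only: line[OF that(1), symmetric])
  from signature obtain e where e: "\<forall>i<n + 1 + n. e i \<in> tangent_space A p"
    "\<forall>i<n + 1 + n. \<forall>j<n + 1 + n.
      g p (e i) (e j) = (if i = j then (if i < n + 1 then 1 else - 1) else 0)"
    unfolding has_signature_def by blast
  have "e 0 \<in> tangent_space A p" "e 1 \<in> tangent_space A p"
    "g p (e 0) (e 0) = 1" "g p (e 1) (e 1) = 1" "g p (e 0) (e 1) = 0"
    using n_pos e by auto
  then show False
    using g[of "e 0" "e 0"] g[of "e 0" "e 1"] g[of "e 1" "e 1"] by auto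
qed

text \<open>The image of \<open>\<phi>\<close> lies in \<open>ker \<eta>\<close>, and there \<open>g\<^sup>~(\<phi> v, \<phi> w) = g(\<phi> v, \<phi> \<phi> w) = - g(\<phi> v, w)\<close>. So a vector
  \<open>v\<close> with \<open>\<phi> v \<noteq> 0\<close> and the nondegeneracy of \<open>g\<close> give the pair.\<close>

lemma associated_metric_horizontal_nonzero:
  obtains x y where "x \<in> tangent_space A p" "y \<in> tangent_space A p"
    "\<eta> p x = 0" "\<eta> p y = 0" "gt p x y \<noteq> 0"
proof -
  obtain v where v: "v \<in> tangent_space A p" "\<phi> p v \<noteq> 0" using phi_nonzero by blast
  obtain w where w: "w \<in> tangent_space A p" "g p (\<phi> p v) w \<noteq> 0"
    using metric_nondegenerate[OF phi_tangent[OF v(1)]] v(2) by blast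
  have "gt p (\<phi> p v) (\<phi> p w) = - g p (\<phi> p v) w"
    using metric_phi_phi[OF v(1) w(1)] v w by (simp add: associated_metric_def eta_phi)
  then show thesis
    using v w by (intro that[of "\<phi> p v" "\<phi> p w"]) (simp_all add: phi_tangent eta_phi)
qed

end

section \<open>Vertical torse-forming potentials\<close>

theorem theorem5p4:
  fixes A :: "('a::{t2_space, second_countable_topology}, 'e::euclidean_space) chart set"
    and n :: nat
    and \<phi> :: "('a, 'e) endo" and \<xi> :: "('a, 'e) vfield" and \<eta> :: "('a, 'e) form1"
    and g gt :: "('a, 'e) form2"
    and nabt :: "('a, 'e) conn"
    and \<theta> :: "('a, 'e) vfield" and l k f :: "'a \<Rightarrow> real" and \<gamma> :: "('a, 'e) form1"
  assumes "accR_manifold n A \<phi> \<xi> \<eta> g"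
    and "gt = associated_metric \<phi> \<eta> g"
    and "levi_civita A gt nabt"
    and "yamabe_almost_soliton A gt nabt \<theta> l"
    and "vertical_potential A \<xi> k \<theta>"
    and "torse_forming A nabt \<theta> f \<gamma>"
  shows "\<forall>p. scalar_curvature A gt nabt p = f p + l p"
proof
  fix p
  interpret accR n A \<phi> \<xi> \<eta> g by (rule accR.intro) (rule assms(1))
  have \<theta>: "\<theta> p = tscale (k p) (\<xi> p)"
    using assms(5) by (simp add: vertical_potential_def fscale_def)
  note add = associated_metric_add[folded assms(2)]
    and scale = associated_metric_scale[folded assms(2)]
    and sym = associated_metric_sym[folded assms(2)]
  obtain x y where xy: "x \<in> tangent_space A p" "y \<in> tangent_space A p"
    "\<eta> p x = 0" "\<eta> p y = 0" "gt p x y \<noteq> 0"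
    using associated_metric_horizontal_nonzero[of p, folded assms(2)] .
  obtain X where X: "smooth_vfield A X" "X p = x" using tangent_vector_extends[OF atlas xy(1)] .
  obtain Y where Y: "smooth_vfield A Y" "Y p = y" using tangent_vector_extends[OF atlas xy(2)] .
  have reeb: "gt p (\<theta> p) v = 0" if "v \<in> tangent_space A p" "\<eta> p v = 0" for v
    using associated_metric_reeb[OF that(1), folded assms(2)] scale[OF reeb_tangent that(1)] that(2) \<theta>
    by simp
  (* For horizontal w the generating form drops out, and the potential acts like a concircular field. *)
  have nab: "gt p (nabt Z \<theta> p) w = f p * gt p (Z p) w"
    if "smooth_vfield A Z" "w \<in> tangent_space A p" "\<eta> p w = 0" for Z w
  proof -
    have Z: "Z p \<in> tangent_space A p" and T: "\<theta> p \<in> tangent_space A p"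
      using that(1) assms(6) by (simp_all add: smooth_vfield_def torse_forming_def)
    have "nabt Z \<theta> p = tscale (f p) (Z p) + tscale (\<gamma> p (Z p)) (\<theta> p)"
      using assms(6) that(1) by (simp add: torse_forming_def)
    then show ?thesis
      using add[OF tangent_space_scale[OF atlas Z] tangent_space_scale[OF atlas T] that(2)]
        scale[OF Z that(2)] scale[OF T that(2)] reeb[OF that(2,3)] by simp
  qed
  have sm: "smooth_vfield A \<theta>" using assms(6) by (simp add: torse_forming_def)
  have "nabt Y \<theta> p \<in> tangent_space A p"
    using assms(3) sm Y(1)
    by (simp add: levi_civita_def affine_connection_def smooth_vfield_def)
  then have "gt p x (nabt Y \<theta> p) = f p * gt p x y"
    using nab[OF Y(1) xy(1,3)] sym[OF xy(1)] sym[OF xy(1,2)] Y(2) by simp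
  moreover have "gt p (nabt X \<theta> p) y = f p * gt p x y"
    using nab[OF X(1) xy(2,4)] X(2) by simp
  moreover have "lie_deriv2 A \<theta> gt X Y p = gt p (nabt X \<theta> p) (Y p) + gt p (X p) (nabt Y \<theta> p)"
  proof (rule lie_derivative_levi_civita[OF atlas assms(3) sm X(1) Y(1)])
    fix u v w assume uv: "u \<in> tangent_space A p" "v \<in> tangent_space A p"
    show "gt p u v = gt p v u" by (rule sym[OF uv])
    assume "w \<in> tangent_space A p"
    then show "gt p (u + v) w = gt p u w + gt p v w" by (rule add[OF uv])
  qed
  ultimately have "lie_deriv2 A \<theta> gt X Y p = 2 * f p * gt p x y" using X(2) Y(2) by simp
  moreover have "1 / 2 * lie_deriv2 A \<theta> gt X Y p = (scalar_curvature A gt nabt p - l p) * gt p x y"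
    using assms(4) X Y by (simp add: yamabe_almost_soliton_def)
  ultimately have "f p * gt p x y = (scalar_curvature A gt nabt p - l p) * gt p x y" by simp
  then show "scalar_curvature A gt nabt p = f p + l p" using xy(5) by simp
qed

end
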